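(* Let $A_k=\{a_1,\dots,a_k\}$ with $1=a_1<a_2<\dots<a_k$ integers, and let $h_0$ be the smallest positive integer $h$ with $n(h)\ge a_k$. Then $n(h+1)\ge n(h)+a_k$ for all integers $h\ge h_0-1$.
   Context: For an integer $h\ge 0$, an integer $x\ge 0$ has an $h$-representation if $x=\sum_{i=1}^k c_ia_i$ with nonnegative integers $c_i$ and $\sum_i c_i\le h$. The $h$-range $n(h)=n(h,A_k)$ is the largest integer $n$ such that every integer $0\le x\le n$ has an $h$-representation. *)

theory Defs
  imports Main
begin

text \<open>The basis \<open>A\<^sub>k = {a\<^sub>1 < \<dots> < a\<^sub>k}\<close> is given by \<open>a :: nat \<Rightarrow> nat\<close>, of which only the values
  \<open>a i\<close> with \<open>1 \<le> i \<le> k\<close> matter.\<close>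

definition is_basis :: "nat \<Rightarrow> (nat \<Rightarrow> nat) \<Rightarrow> bool" where
  "is_basis k a \<longleftrightarrow> 1 \<le> k \<and> a 1 = 1 \<and> strict_mono_on {1..k} a"

definition has_representation :: "nat \<Rightarrow> (nat \<Rightarrow> nat) \<Rightarrow> nat \<Rightarrow> nat \<Rightarrow> bool" where
  "has_representation k a h x \<longleftrightarrow>
     (\<exists>c :: nat \<Rightarrow> nat. x = (\<Sum>i=1..k. c i * a i) \<and> (\<Sum>i=1..k. c i) \<le> h)"

definition h_range :: "nat \<Rightarrow> (nat \<Rightarrow> nat) \<Rightarrow> nat \<Rightarrow> nat" where
  "h_range k a h = (GREATEST n. \<forall>x\<le>n. has_representation k a h x)"

definition h_zero :: "nat \<Rightarrow> (nat \<Rightarrow> nat) \<Rightarrow> nat" where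
  "h_zero k a = (LEAST h. 0 < h \<and> a k \<le> h_range k a h)"

text \<open>The maximum in \<open>h_range\<close> and the minimum in \<open>h_zero\<close> exist for every basis.\<close>

lemma has_representation_le:
  assumes "is_basis k a" "has_representation k a h x"
  shows "x \<le> h * a k"
proof -
  obtain c where x: "x = (\<Sum>i=1..k. c i * a i)" and c: "(\<Sum>i=1..k. c i) \<le> h"
    using assms(2) unfolding has_representation_def by blast
  have "a i \<le> a k" if "i \<in> {1..k}" for i
    using assms(1) that unfolding is_basis_def strict_mono_on_def
    by (cases "i = k") (auto intro: less_imp_le)
  then have "x \<le> (\<Sum>i=1..k. c i * a k)"
    unfolding x by (intro sum_mono mult_le_mono2)
  also have "\<dots> = (\<Sum>i=1..k. c i) * a k"
    by (simp add: sum_distrib_right)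
  also have "\<dots> \<le> h * a k"
    using c by (rule mult_le_mono1)
  finally show ?thesis .
qed

lemma has_representation_self:
  assumes "is_basis k a" "x \<le> h"
  shows "has_representation k a h x"
proof -
  let ?c = "\<lambda>i. if i = 1 then x else 0"
  have "(\<Sum>i=1..k. ?c i * a i) = (\<Sum>i=1..k. ?c i)"
    using assms(1) by (intro sum.cong) (auto simp: is_basis_def)
  moreover have "(\<Sum>i=1..k. ?c i) = x"
    using assms(1) by (simp add: is_basis_def)
  ultimately show ?thesis
    unfolding has_representation_def using assms(2) by (intro exI[of _ ?c]) simp
qed

lemma h_range_greatest:
  assumes "is_basis k a"
  shows "\<forall>x\<le>h_range k a h. has_representation k a h x"
    and "\<forall>x\<le>n. has_representation k a h x \<Longrightarrow> n \<le> h_range k a h"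
proof -
  let ?P = "\<lambda>n. \<forall>x\<le>n. has_representation k a h x"
  have bound: "n \<le> h * a k" if "?P n" for n
    using has_representation_le[OF assms] that by blast
  have "?P h"
    using has_representation_self[OF assms] by blast
  then show "?P (h_range k a h)"
    unfolding h_range_def by (rule GreatestI_nat) (use bound in blast)
  show "n \<le> h_range k a h" if "?P n"
    unfolding h_range_def using that by (rule Greatest_le_nat) (use bound in blast)
qed

lemma h_zero_least:
  assumes "is_basis k a"
  shows "0 < h_zero k a" and "a k \<le> h_range k a (h_zero k a)"
    and "0 < h \<Longrightarrow> a k \<le> h_range k a h \<Longrightarrow> h_zero k a \<le> h"
proof -
  let ?P = "\<lambda>h. 0 < h \<and> a k \<le> h_range k a h"
  have "0 < a k"
    using assms strict_mono_onD[of "{1..k}" a 1 k]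
    by (cases "k = 1") (auto simp: is_basis_def)
  moreover have "a k \<le> h_range k a (a k)"
    using has_representation_self[OF assms] by (intro h_range_greatest(2)[OF assms]) blast
  ultimately have "?P (a k)" by blast
  then have "?P (h_zero k a)"
    unfolding h_zero_def by (rule LeastI)
  then show "0 < h_zero k a" and "a k \<le> h_range k a (h_zero k a)" by blast+
  show "h_zero k a \<le> h" if "0 < h" "a k \<le> h_range k a h"
    unfolding h_zero_def using that by (intro Least_le) blast
qed

end

theory Submission
  imports Defs
begin

text \<open>Every \<open>x\<close> up to \<open>h_range k a h + a k\<close> gets a representation
  with \<open>h + 1\<close> summands. Above \<open>a k\<close>, remove one copy of
  \<open>a k\<close>: the rest lies within the \<open>h\<close>-range, and
  \<open>has_representation_add_last\<close> puts the copy back. Up to \<open>a k\<close>,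
  \<open>x\<close> lies within the range for \<open>h_zero k a\<close>, and
  \<open>has_representation_mono\<close> lifts its representation to \<open>h + 1\<close>.\<close>

lemma has_representation_mono:
  assumes "has_representation k a h x" "h \<le> h'"
  shows "has_representation k a h' x"
  using assms unfolding has_representation_def by (blast intro: le_trans)

text \<open>Raising the coefficient of \<open>a k\<close> by one costs exactly one summand.\<close>

lemma has_representation_add_last:
  assumes "1 \<le> k" "has_representation k a h x"
  shows "has_representation k a (h + 1) (x + a k)"
proof -
  obtain c where x: "x = (\<Sum>i=1..k. c i * a i)" and c: "(\<Sum>i=1..k. c i) \<le> h"
    using assms(2) unfolding has_representation_def by blast
  let ?d = "\<lambda>i. c i + (if i = k then 1 else 0)"
  have "?d i * a i = c i * a i + (if i = k then a k else 0)" for i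
    by simp
  then have "(\<Sum>i=1..k. ?d i * a i) = x + a k"
    using assms(1) by (simp only: x sum.distrib) simp
  moreover have "(\<Sum>i=1..k. ?d i) \<le> h + 1"
    using assms(1) c by (simp add: sum.distrib)
  ultimately show ?thesis
    unfolding has_representation_def by (intro exI[of _ ?d]) simp
qed

theorem theorem1:
  fixes k :: nat and a :: "nat \<Rightarrow> nat"
  assumes "is_basis k a"
  shows "\<forall>h \<ge> h_zero k a - 1. h_range k a (h + 1) \<ge> h_range k a h + a k"
proof (intro allI impI)
  fix h assume "h \<ge> h_zero k a - 1"
  \<comment> \<open>Only \<open>h + 1\<close>, not \<open>h\<close>, has to reach
    \<open>h_zero k a\<close>; hence the threshold \<open>h_zero k a - 1\<close>.\<close>
  then have h: "h_zero k a \<le> h + 1" by simp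
  have k: "1 \<le> k" using assms by (simp add: is_basis_def)
  have "has_representation k a (h + 1) x" if x: "x \<le> h_range k a h + a k" for x
  proof (cases "x \<le> a k")
    case True
    then have "x \<le> h_range k a (h_zero k a)"
      using h_zero_least(2)[OF assms] by simp
    then show ?thesis
      using h_range_greatest(1)[OF assms] has_representation_mono h by blast
  next
    \<comment> \<open>Here \<open>a k < x\<close>, so the truncated difference
      \<open>x - a k\<close> is exact and adding \<open>a k\<close> recovers
      \<open>x\<close>.\<close>
    case False
    then have "has_representation k a h (x - a k)"
      using x h_range_greatest(1)[OF assms] by simp
    then show ?thesis
      using has_representation_add_last[OF k] False by fastforce
  qed
  then show "h_range k a (h + 1) \<ge> h_range k a h + a k"
    by (intro h_range_greatest(2)[OF assms]) blast
qed

end
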